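(* Let $F\in\mathcal{E}^m$ be essentially smooth, and let $(A,B)$ be a partition of the set of entries $\{(i,j):1\le i\le j\le m\}$ of symmetric $m\times m$ matrices, so that every $\Sigma\in\mathbb{S}^m$ splits as $\Sigma=(\Sigma_A,\Sigma_B)$. For $\Sigma\in\mathbb{S}^m_+$ write $L=\nabla F(\Sigma)$. Then $\Sigma\mapsto(\Sigma_A,L_B)$ is a one-to-one correspondence (bijection) between $\mathbb{S}^m_+$ and $(\mathbb{S}^m_+)_A\times(\mathbb{L}^m_+)_B$.
   Context: $\mathbb{S}^m$ is the space of real symmetric $m\times m$ matrices with inner product $\langle A,B\rangle=\mathrm{tr}(AB)$ and Frobenius norm $\|\cdot\|_F$; $\mathbb{S}^m_+$ and $\overline{\mathbb{S}}^m_+$ are the subsets of positive definite and positive semidefinite matrices. $\mathcal{E}^m$ is the set of functions $F:\mathbb{S}^m\to\mathbb{R}\cup\{+\infty\}$ such that (i) $F$ is convex, not identically $+\infty$, and lower semicontinuous; (ii) $\mathbb{S}^m_+\subseteq\mathrm{dom}(F)\subseteq\overline{\mathbb{S}}^m_+$, where $\mathrm{dom}(F)=\{F<+\infty\}$; (iii) $F$ is strictly convex and continuously differentiable on $\mathbb{S}^m_+$. Gradients are with respect to $\langle\cdot,\cdot\rangle$. $F$ is essentially smooth if it is differentiable on $\mathrm{int}(\mathrm{dom}(F))$ $(=\mathbb{S}^m_+)$ and $\|\nabla F(\Sigma_k)\|_F\to\infty$ for every sequence $(\Sigma_k)$ in $\mathrm{int}(\mathrm{dom}(F))$ converging to a boundary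 point of $\mathrm{dom}(F)$. $\mathbb{L}^m_+:=\nabla F(\mathbb{S}^m_+)$. $(\mathbb{S}^m_+)_A=\{\Sigma_A:\Sigma\in\mathbb{S}^m_+\}$ and $(\mathbb{L}^m_+)_B=\{L_B:L\in\mathbb{L}^m_+\}$ are the coordinate projections. *)

theory Defs
  imports "HOL-Analysis.Analysis"
begin

text \<open>
  The space of symmetric matrices is rendered as a subset of the type of all square matrices.
  A function on it is a function on all square matrices of which only the values on
  symmetric arguments are ever used; accordingly, limits, derivatives, interiors and frontiers are
  all taken relative to the subspace. The library norm on the matrix type is the
  Frobenius norm.
\<close>

definition sym_mats :: "(real^'m^'m) set" where
  "sym_mats = {X. transpose X = X}"

definition pos_def :: "(real^'m^'m) set" where
  "pos_def = {X \<in> sym_mats. \<forall>v. v \<noteq> 0 \<longrightarrow> v \<bullet> (X *v v) > 0}"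

definition pos_semidef :: "(real^'m^'m) set" where
  "pos_semidef = {X \<in> sym_mats. \<forall>v. v \<bullet> (X *v v) \<ge> 0}"

definition edom :: "(real^'m^'m \<Rightarrow> ereal) \<Rightarrow> (real^'m^'m) set" where
  "edom F = {X \<in> sym_mats. F X < \<infinity>}"

definition int_dom :: "(real^'m^'m \<Rightarrow> ereal) \<Rightarrow> (real^'m^'m) set" where
  "int_dom F = (top_of_set sym_mats) interior_of (edom F)"

definition bdry_dom :: "(real^'m^'m \<Rightarrow> ereal) \<Rightarrow> (real^'m^'m) set" where
  "bdry_dom F = (top_of_set sym_mats) frontier_of (edom F)"

definition econvex :: "(real^'m^'m \<Rightarrow> ereal) \<Rightarrow> bool" where
  "econvex F \<longleftrightarrow> (\<forall>X\<in>sym_mats. \<forall>Y\<in>sym_mats. \<forall>t. 0 < t \<and> t < 1 \<longrightarrow>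
     F (t *\<^sub>R X + (1 - t) *\<^sub>R Y) \<le> ereal t * F X + ereal (1 - t) * F Y)"

definition strictly_convex_on :: "(real^'m^'m) set \<Rightarrow> (real^'m^'m \<Rightarrow> ereal) \<Rightarrow> bool" where
  "strictly_convex_on S F \<longleftrightarrow> (\<forall>X\<in>S. \<forall>Y\<in>S. \<forall>t. X \<noteq> Y \<and> 0 < t \<and> t < 1 \<longrightarrow>
     F (t *\<^sub>R X + (1 - t) *\<^sub>R Y) < ereal t * F X + ereal (1 - t) * F Y)"

definition lower_semicont :: "(real^'m^'m \<Rightarrow> ereal) \<Rightarrow> bool" where
  "lower_semicont F \<longleftrightarrow> (\<forall>X\<in>sym_mats. F X \<le> Liminf (at X within sym_mats) F)"

text \<open>
  The gradient with respect to the trace inner product. Requiring G to be symmetric makes it unique,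
  and the point to be interior to the domain makes the junk value of \<open>real_of_ereal\<close> at infinity
  irrelevant.
\<close>

definition has_gradient :: "(real^'m^'m \<Rightarrow> ereal) \<Rightarrow> real^'m^'m \<Rightarrow> real^'m^'m \<Rightarrow> bool" where
  "has_gradient F G X \<longleftrightarrow> X \<in> int_dom F \<and> G \<in> sym_mats \<and>
     ((\<lambda>Y. real_of_ereal (F Y)) has_derivative (\<lambda>H. trace (G ** H))) (at X within sym_mats)"

definition grad :: "(real^'m^'m \<Rightarrow> ereal) \<Rightarrow> real^'m^'m \<Rightarrow> real^'m^'m" where
  "grad F X = (THE G. has_gradient F G X)"

definition class_E :: "(real^'m^'m \<Rightarrow> ereal) set" where
  "class_E = {F.
     (\<forall>X\<in>sym_mats. F X \<noteq> -\<infinity>) \<and>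
     econvex F \<and> (\<exists>X\<in>sym_mats. F X \<noteq> \<infinity>) \<and> lower_semicont F \<and>
     pos_def \<subseteq> edom F \<and> edom F \<subseteq> pos_semidef \<and>
     strictly_convex_on pos_def F \<and>
     (\<forall>X\<in>pos_def. \<exists>G. has_gradient F G X) \<and> continuous_on pos_def (grad F)}"

definition essentially_smooth :: "(real^'m^'m \<Rightarrow> ereal) \<Rightarrow> bool" where
  "essentially_smooth F \<longleftrightarrow>
     (\<forall>X\<in>int_dom F. \<exists>G. has_gradient F G X) \<and>
     (\<forall>S X. (\<forall>k::nat. S k \<in> int_dom F) \<and> X \<in> bdry_dom F \<and> S \<longlonglongrightarrow> X \<longrightarrow>
        filterlim (\<lambda>k. norm (grad F (S k))) at_top sequentially)"

definition L_plus :: "(real^'m^'m \<Rightarrow> ereal) \<Rightarrow> (real^'m^'m) set" where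
  "L_plus F = grad F ` pos_def"

definition entries :: "('m::{finite,linorder} \<times> 'm) set" where
  "entries = {(i, j). i \<le> j}"

text \<open>Outside the index set \<open>A\<close> the projection takes the constant value \<open>undefined\<close>.\<close>

definition coords :: "('m \<times> 'm) set \<Rightarrow> real^'m^'m \<Rightarrow> ('m \<times> 'm \<Rightarrow> real)" where
  "coords A X = restrict (\<lambda>(i, j). X $ i $ j) A"

end

theory Submission
  imports Defs
begin

text \<open>
  Injectivity: if two positive definite matrices agree on the entries in \<open>A\<close> and their gradients
  agree on the entries in \<open>B\<close>, then the difference of the matrices is orthogonal to the
  difference of the gradients (lemma \<open>inner_eq_zero_if_complementary\<close>). The gradient of a
  strictly convex function is strictly monotone (lemma \<open>grad_strict_mono\<close>), so the two matrices
  coincide.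

  Surjectivity: given positive definite \<open>P\<close> and \<open>Q\<close> with \<open>L = grad F Q\<close>, minimise the tilted
  function \<open>F Y - L \<bullet> Y\<close> over the symmetric matrices \<open>Y\<close> that agree with \<open>P\<close> on \<open>A\<close>.
  \<^item> The point \<open>Q\<close> is the strict global minimiser of the tilted function, which therefore grows at
    least linearly away from \<open>Q\<close> (lemma \<open>tilted_coercive\<close>). With lower semicontinuity this gives
    a minimiser \<open>X\<close> on the affine slice (lemma \<open>tilted_attains_min\<close>).
  \<^item> Essential smoothness puts \<open>X\<close> into the positive definite cone (lemma
    \<open>minimizer_pos_def\<close>): otherwise \<open>X\<close> is a boundary point of the domain, and the gradients of
    the tilted function blow up along the segment from \<open>P\<close> to \<open>X\<close>. They have nonnegative
    inner product with \<open>P - X\<close>, because \<open>X\<close> is a minimiser, so the supporting hyperplanes along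
    the segment would force the tilted function to be unbounded on a small closed ball around \<open>P\<close>,
    where it is continuous.
  \<^item> At the minimiser \<open>X\<close> the derivative of the tilted function vanishes in every symmetric
    direction supported on \<open>B\<close>, that is, \<open>grad F X\<close> and \<open>L\<close> agree on \<open>B\<close>.
\<close>

section \<open>Symmetric matrices\<close>

text \<open>The finite values of an extended-valued function, meaningful only on its domain.\<close>

abbreviation rval :: "(real^'m^'m \<Rightarrow> ereal) \<Rightarrow> real^'m^'m \<Rightarrow> real" where
  "rval F X \<equiv> real_of_ereal (F X)"

lemma subspace_sym_mats: "subspace (sym_mats :: (real^'m^'m) set)"
  by (auto simp: subspace_def sym_mats_def transpose_def vec_eq_iff)

lemma closed_sym_mats: "closed (sym_mats :: (real^'m^'m) set)"
  by (rule closed_subspace[OF subspace_sym_mats])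

lemma sym_mats_nth: "X \<in> sym_mats \<Longrightarrow> X $ i $ j = X $ j $ i"
  by (auto simp: sym_mats_def transpose_def vec_eq_iff)

lemma trace_mult_sym:
  fixes G H :: "real^'m^'m"
  assumes "H \<in> sym_mats"
  shows "trace (G ** H) = G \<bullet> H"
proof -
  have "trace (G ** H) = (\<Sum>i\<in>UNIV. \<Sum>j\<in>UNIV. G $ i $ j * H $ j $ i)"
    by (simp add: trace_def matrix_matrix_mult_def)
  also have "\<dots> = (\<Sum>i\<in>UNIV. \<Sum>j\<in>UNIV. G $ i $ j * H $ i $ j)"
    by (intro sum.cong refl arg_cong2[where f = "(*)"] sym_mats_nth[OF assms])
  finally show ?thesis by (simp add: inner_vec_def)
qed

lemma convex_combination_sym:
  "X \<in> sym_mats \<Longrightarrow> Y \<in> sym_mats \<Longrightarrow> t *\<^sub>R X + s *\<^sub>R Y \<in> sym_mats"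
  by (intro subspace_add subspace_scale subspace_sym_mats)

lemma pos_def_sym: "X \<in> pos_def \<Longrightarrow> X \<in> sym_mats"
  by (simp add: pos_def_def)

lemma edom_sym: "X \<in> edom F \<Longrightarrow> X \<in> sym_mats"
  by (simp add: edom_def)

lemma pos_def_segment:
  fixes P X :: "real^'m^'m"
  assumes "P \<in> pos_def" "X \<in> pos_semidef" "0 < t" "t \<le> 1"
  shows "t *\<^sub>R P + (1 - t) *\<^sub>R X \<in> pos_def"
proof -
  have "v \<bullet> ((t *\<^sub>R P + (1 - t) *\<^sub>R X) *v v) > 0" if "v \<noteq> 0" for v
  proof -
    have "v \<bullet> ((t *\<^sub>R P + (1 - t) *\<^sub>R X) *v v) = t * (v \<bullet> (P *v v)) + (1 - t) * (v \<bullet> (X *v v))"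
      by (simp add: matrix_vector_mult_add_rdistrib scaleR_matrix_vector_assoc[symmetric] inner_add_right)
    moreover have "t * (v \<bullet> (P *v v)) > 0" "(1 - t) * (v \<bullet> (X *v v)) \<ge> 0"
      using assms that by (auto simp: pos_def_def pos_semidef_def)
    ultimately show ?thesis by linarith
  qed
  then show ?thesis
    using assms by (auto simp: pos_def_def pos_semidef_def intro!: convex_combination_sym)
qed

lemma inner_eq_zero_if_complementary:
  fixes D M :: "real^('m::{finite,linorder})^('m::{finite,linorder})"
  assumes "A \<union> B = entries" "D \<in> sym_mats" "M \<in> sym_mats"
    and D: "\<And>i j. (i, j) \<in> A \<Longrightarrow> D $ i $ j = 0" and M: "\<And>i j. (i, j) \<in> B \<Longrightarrow> M $ i $ j = 0"
  shows "D \<bullet> M = 0"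
proof -
  have upper: "D $ i $ j * M $ i $ j = 0" if "i \<le> j" for i j
  proof -
    have "(i, j) \<in> A \<union> B" using that assms(1) by (simp add: entries_def)
    then show ?thesis using D M by auto
  qed
  have "D $ i $ j * M $ i $ j = 0" for i j
    using upper[of i j] upper[of j i] sym_mats_nth[OF assms(2), of i j] sym_mats_nth[OF assms(3), of i j]
    by (cases "i \<le> j") auto
  then show ?thesis unfolding inner_vec_def inner_real_def by (intro sum.neutral ballI) blast
qed

lemma coords_eq_iff:
  "coords A X = coords A Y \<longleftrightarrow> (\<forall>i j. (i, j) \<in> A \<longrightarrow> X $ i $ j = Y $ i $ j)"
  by (auto simp: coords_def restrict_def fun_eq_iff)

lemma closed_coords_fiber: "closed {Y :: real^'m^'m. coords A Y = coords A P}"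
proof -
  have "closed (\<Inter>p\<in>A. {Y :: real^'m^'m. Y $ fst p $ snd p = P $ fst p $ snd p})"
    by (intro closed_INT ballI closed_Collect_eq continuous_intros)
  also have "(\<Inter>p\<in>A. {Y :: real^'m^'m. Y $ fst p $ snd p = P $ fst p $ snd p})
      = {Y. coords A Y = coords A P}"
    by (force simp: coords_eq_iff)
  finally show ?thesis .
qed

section \<open>Gradients of functions in the class\<close>

lemma has_gradient_line:
  fixes F :: "real^'m^'m \<Rightarrow> ereal"
  assumes "has_gradient F G X" "H \<in> sym_mats"
  shows "((\<lambda>t. rval F (X + t *\<^sub>R H)) has_real_derivative G \<bullet> H) (at 0)"
proof -
  have X: "X \<in> sym_mats"
    using assms(1) interior_of_subset_topspace[of "top_of_set sym_mats" "edom F"]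
    by (auto simp: has_gradient_def int_dom_def)
  have 1: "((\<lambda>t. X + t *\<^sub>R H) has_derivative (\<lambda>t. t *\<^sub>R H)) (at 0 within UNIV)"
    by (auto intro!: derivative_eq_intros)
  have sub: "range (\<lambda>t. X + t *\<^sub>R H) \<subseteq> sym_mats"
    using X assms(2) by (auto intro: subspace_add subspace_scale subspace_sym_mats)
  have "(rval F has_derivative (\<lambda>H. trace (G ** H))) (at X within range (\<lambda>t. X + t *\<^sub>R H))"
    using assms(1) has_derivative_subset[OF _ sub] by (auto simp: has_gradient_def)
  then have "(rval F has_derivative (\<lambda>H. trace (G ** H)))
      (at (X + 0 *\<^sub>R H) within range (\<lambda>t. X + t *\<^sub>R H))"
    by simp
  from diff_chain_within[OF 1 this]
  have "((\<lambda>t. rval F (X + t *\<^sub>R H)) has_derivative (\<lambda>t. trace (G ** (t *\<^sub>R H)))) (at 0)"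
    by (simp add: o_def)
  moreover have "(\<lambda>t. trace (G ** (t *\<^sub>R H))) = (*) (G \<bullet> H)"
    using assms(2) by (auto simp: trace_mult_sym subspace_scale[OF subspace_sym_mats])
  ultimately show ?thesis
    by (simp add: has_field_derivative_def)
qed

lemma has_gradient_unique:
  fixes F :: "real^'m^'m \<Rightarrow> ereal"
  assumes "has_gradient F G X" "has_gradient F G' X"
  shows "G = G'"
proof -
  have D: "G - G' \<in> sym_mats"
    using assms by (auto simp: has_gradient_def intro: subspace_diff subspace_sym_mats)
  have "G \<bullet> (G - G') = G' \<bullet> (G - G')"
    using has_gradient_line[OF assms(1) D] has_gradient_line[OF assms(2) D] DERIV_unique by blast
  then have "(G - G') \<bullet> (G - G') = 0" by (simp add: inner_diff_left)
  then show ?thesis by simp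
qed

context
  fixes F :: "real^'m^'m \<Rightarrow> ereal"
  assumes F: "F \<in> class_E"
begin

lemma has_gradient_grad:
  assumes "X \<in> pos_def"
  shows "has_gradient F (grad F X) X"
proof -
  obtain G where "has_gradient F G X" using F assms by (auto simp: class_E_def)
  then have "\<exists>!G. has_gradient F G X" using has_gradient_unique by blast
  then show ?thesis unfolding grad_def by (rule theI')
qed

lemma grad_sym: "X \<in> pos_def \<Longrightarrow> grad F X \<in> sym_mats"
  using has_gradient_grad by (auto simp: has_gradient_def)

lemma pos_def_edom: "X \<in> pos_def \<Longrightarrow> X \<in> edom F"
  using F by (auto simp: class_E_def)

lemma edom_pos_semidef: "X \<in> edom F \<Longrightarrow> X \<in> pos_semidef"
  using F by (auto simp: class_E_def)

lemma edom_value: "X \<in> edom F \<Longrightarrow> F X = ereal (rval F X)"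
  using F by (cases "F X") (auto simp: edom_def class_E_def)

lemma int_dom_eq_pos_def: "int_dom F = pos_def"
proof
  show "pos_def \<subseteq> int_dom F"
    using has_gradient_grad by (auto simp: has_gradient_def)
  show "int_dom F \<subseteq> pos_def"
  proof
    fix X assume "X \<in> int_dom F"
    moreover have "openin (top_of_set sym_mats) (int_dom F)"
      by (simp add: int_dom_def)
    ultimately obtain e where e: "e > 0" "cball X e \<inter> sym_mats \<subseteq> int_dom F" and X: "X \<in> sym_mats"
      unfolding openin_contains_cball by blast
    have IE: "int_dom F \<subseteq> edom F" by (simp add: int_dom_def interior_of_subset)
    \<comment> \<open>Since \<open>X\<close> minus a small multiple of the identity is still positive semidefinite, \<open>X\<close> is definite.\<close>
    define c where "c = e / (norm (mat 1 :: real^'m^'m) + 1)"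
    have c: "c > 0" using e by (auto simp: c_def intro!: divide_pos_pos add_nonneg_pos)
    have "c * norm (mat 1 :: real^'m^'m) \<le> c * (norm (mat 1 :: real^'m^'m) + 1)"
      using c by simp
    also have "\<dots> = e"
      using add_nonneg_pos[OF norm_ge_zero zero_less_one, of "mat 1 :: real^'m^'m"]
      by (simp add: c_def)
    finally have n: "c * norm (mat 1 :: real^'m^'m) \<le> e" .
    have "X - c *\<^sub>R mat 1 \<in> sym_mats"
      using X by (intro subspace_diff subspace_scale subspace_sym_mats) (auto simp: sym_mats_def)
    moreover have "X - c *\<^sub>R mat 1 \<in> cball X e"
      using n c by (simp add: dist_norm)
    ultimately have "X - c *\<^sub>R mat 1 \<in> pos_semidef"
      using e IE edom_pos_semidef by blast
    then have *: "v \<bullet> ((X - c *\<^sub>R mat 1) *v v) \<ge> 0" for v by (simp add: pos_semidef_def)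
    have "v \<bullet> (X *v v) > 0" if "v \<noteq> 0" for v
    proof -
      have "0 \<le> v \<bullet> (X *v v) - c * (v \<bullet> v)"
        using *[of v]
        by (simp add: matrix_vector_mult_diff_rdistrib scaleR_matrix_vector_assoc[symmetric] inner_diff_right)
      moreover have "c * (v \<bullet> v) > 0" using c that by simp
      ultimately show ?thesis by linarith
    qed
    then show "X \<in> pos_def" using X by (simp add: pos_def_def)
  qed
qed

lemma pos_def_ball:
  fixes X :: "real^'m^'m"
  assumes "X \<in> pos_def"
  obtains r where "r > 0" "cball X r \<inter> sym_mats \<subseteq> pos_def"
proof -
  have "openin (top_of_set sym_mats) (int_dom F)"
    by (simp add: int_dom_def)
  then show ?thesis
    using that assms unfolding openin_contains_cball int_dom_eq_pos_def by blast
qed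

lemma rval_convex:
  assumes "X \<in> edom F" "Y \<in> edom F" "0 < t" "t < 1"
  shows "t *\<^sub>R X + (1 - t) *\<^sub>R Y \<in> edom F"
    and "rval F (t *\<^sub>R X + (1 - t) *\<^sub>R Y) \<le> t * rval F X + (1 - t) * rval F Y"
proof -
  let ?Z = "t *\<^sub>R X + (1 - t) *\<^sub>R Y"
  have "F ?Z \<le> ereal t * F X + ereal (1 - t) * F Y"
    using F assms by (auto simp: class_E_def econvex_def edom_def)
  then have le: "F ?Z \<le> ereal (t * rval F X + (1 - t) * rval F Y)"
    using edom_value[OF assms(1)] edom_value[OF assms(2)] by (metis times_ereal.simps(1) plus_ereal.simps(1))
  then show Z: "?Z \<in> edom F"
    using assms by (auto simp: edom_def intro: convex_combination_sym)
  show "rval F ?Z \<le> t * rval F X + (1 - t) * rval F Y"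
    using le edom_value[OF Z] by (metis ereal_less_eq(3))
qed

lemma rval_strictly_convex:
  assumes "X \<in> pos_def" "Y \<in> pos_def" "X \<noteq> Y" "0 < t" "t < 1"
  shows "rval F (t *\<^sub>R X + (1 - t) *\<^sub>R Y) < t * rval F X + (1 - t) * rval F Y"
proof -
  let ?Z = "t *\<^sub>R X + (1 - t) *\<^sub>R Y"
  have E: "X \<in> edom F" "Y \<in> edom F" using assms pos_def_edom by auto
  have "F ?Z < ereal t * F X + ereal (1 - t) * F Y"
    using F assms by (auto simp: class_E_def strictly_convex_on_def)
  then have "F ?Z < ereal (t * rval F X + (1 - t) * rval F Y)"
    using edom_value[OF E(1)] edom_value[OF E(2)] by (metis times_ereal.simps(1) plus_ereal.simps(1))
  then show ?thesis
    using edom_value[OF rval_convex(1)[OF E assms(4,5)]] by (metis ereal_less(2) less_ereal.simps(1))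
qed

lemma continuous_on_rval: "continuous_on pos_def (rval F)"
proof -
  have "continuous (at X within sym_mats) (rval F)" if "X \<in> pos_def" for X
    using has_gradient_grad[OF that] has_derivative_continuous by (auto simp: has_gradient_def)
  then show ?thesis
    using continuous_within_subset[of _ sym_mats "rval F" pos_def] pos_def_sym
    by (auto simp: continuous_on_eq_continuous_within)
qed

lemma gradient_inequality:
  assumes "X \<in> pos_def" "Y \<in> edom F"
  shows "rval F X + grad F X \<bullet> (Y - X) \<le> rval F Y"
proof -
  let ?f = "\<lambda>t. rval F (X + t *\<^sub>R (Y - X))"
  have H: "Y - X \<in> sym_mats"
    using assms pos_def_sym edom_sym by (auto intro: subspace_diff subspace_sym_mats)
  have "((\<lambda>t. (?f (0 + t) - ?f 0) / t) \<longlongrightarrow> grad F X \<bullet> (Y - X)) (at 0)"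
    using has_gradient_line[OF has_gradient_grad[OF assms(1)] H] by (simp add: DERIV_def)
  then have lim: "((\<lambda>t. (?f (0 + t) - ?f 0) / t) \<longlongrightarrow> grad F X \<bullet> (Y - X)) (at_right 0)"
    by (rule tendsto_mono[OF at_le, rotated]) simp
  have "(?f (0 + t) - ?f 0) / t \<le> rval F Y - rval F X" if "0 < t" "t < 1" for t
  proof -
    have eq: "X + t *\<^sub>R (Y - X) = t *\<^sub>R Y + (1 - t) *\<^sub>R X" by (simp add: algebra_simps)
    have "?f t \<le> t * rval F Y + (1 - t) * rval F X"
      unfolding eq using rval_convex(2)[OF assms(2) pos_def_edom[OF assms(1)] that] .
    then show ?thesis using that by (simp add: field_simps)
  qed
  then have "\<forall>\<^sub>F t in at_right 0. (?f (0 + t) - ?f 0) / t \<le> rval F Y - rval F X"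
    by (auto simp: eventually_at_right_field intro!: exI[of _ 1])
  from tendsto_upperbound[OF lim this] show ?thesis by simp
qed

lemma gradient_inequality_strict:
  assumes "X \<in> pos_def" "Y \<in> pos_def" "X \<noteq> Y"
  shows "rval F X + grad F X \<bullet> (Y - X) < rval F Y"
proof -
  let ?M = "(1/2) *\<^sub>R Y + (1 - 1/2) *\<^sub>R X"
  have "rval F ?M < (1/2) * rval F Y + (1 - 1/2) * rval F X"
    using assms by (intro rval_strictly_convex) auto
  moreover have "rval F X + grad F X \<bullet> (?M - X) \<le> rval F ?M"
    using assms pos_def_edom by (intro gradient_inequality rval_convex(1)) auto
  moreover have "?M - X = (1/2) *\<^sub>R (Y - X)"
    by (simp add: algebra_simps vec_eq_iff)
  ultimately show ?thesis by simp
qed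

lemma grad_strict_mono:
  assumes "X \<in> pos_def" "Y \<in> pos_def" "X \<noteq> Y"
  shows "(Y - X) \<bullet> (grad F Y - grad F X) > 0"
proof -
  have "grad F X \<bullet> (Y - X) + grad F Y \<bullet> (X - Y) < 0"
    using gradient_inequality_strict[OF assms]
      gradient_inequality_strict[OF assms(2,1) assms(3)[symmetric]] by linarith
  moreover have "(Y - X) \<bullet> (grad F Y - grad F X) = - (grad F X \<bullet> (Y - X) + grad F Y \<bullet> (X - Y))"
    by (subst inner_commute) (simp add: inner_diff_left inner_diff_right)
  ultimately show ?thesis by simp
qed

section \<open>Minimising a tilted function on an affine slice\<close>

text \<open>
  The strict minimiser \<open>Q\<close> of the tilted function has a positive gap on a small sphere around
  it, and convexity propagates this gap linearly along rays.
\<close>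

lemma tilted_coercive:
  assumes Q: "Q \<in> pos_def"
  obtains r e where "r > 0" "e > 0"
    "\<And>Y. Y \<in> edom F \<Longrightarrow> r \<le> norm (Y - Q) \<Longrightarrow>
      rval F Q - grad F Q \<bullet> Q + e * norm (Y - Q) \<le> rval F Y - grad F Q \<bullet> Y"
proof -
  let ?g = "\<lambda>Y. rval F Y - grad F Q \<bullet> Y"
  obtain r where r: "r > 0" "cball Q r \<inter> sym_mats \<subseteq> pos_def"
    using pos_def_ball[OF Q] .
  let ?S = "sphere Q r \<inter> sym_mats"
  have SP: "?S \<subseteq> pos_def" using r(2) by auto
  have comp: "compact ?S"
    by (intro compact_Int_closed compact_sphere closed_sym_mats)
  have cont: "continuous_on ?S ?g"
    by (intro continuous_intros continuous_on_subset[OF continuous_on_rval SP])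
  have "\<exists>e>0. \<forall>Z\<in>?S. ?g Q + e \<le> ?g Z"
  proof (cases "?S = {}")
    case False
    obtain Z0 where Z0: "Z0 \<in> ?S" "\<forall>Z\<in>?S. ?g Z0 \<le> ?g Z"
      using continuous_attains_inf[OF comp False cont] by blast
    have "Z0 \<noteq> Q" using Z0 r(1) by auto
    then have "?g Q < ?g Z0"
      using gradient_inequality_strict[OF Q, of Z0] Z0 SP by (auto simp: inner_diff_right)
    then show ?thesis using Z0 by (intro exI[of _ "?g Z0 - ?g Q"]) auto
  qed (auto intro: exI[of _ 1])
  then obtain e where e: "e > 0" "\<And>Z. Z \<in> ?S \<Longrightarrow> ?g Q + e \<le> ?g Z" by blast
  have "?g Q + e / r * norm (Y - Q) \<le> ?g Y" if Y: "Y \<in> edom F" "r \<le> norm (Y - Q)" for Y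
  proof -
    define t where "t = r / norm (Y - Q)"
    have n: "norm (Y - Q) > 0" using r Y by linarith
    have t: "0 < t" "t \<le> 1" using n r Y by (auto simp: t_def)
    let ?Z = "t *\<^sub>R Y + (1 - t) *\<^sub>R Q"
    have "?Z - Q = t *\<^sub>R (Y - Q)" by (simp add: algebra_simps)
    then have "norm (?Z - Q) = r" using n r(1) by (simp add: t_def)
    then have "?Z \<in> ?S"
      using Y Q by (auto simp: dist_norm norm_minus_commute edom_sym pos_def_sym intro!: convex_combination_sym)
    then have 1: "?g Q + e \<le> ?g ?Z" using e by blast
    have "rval F ?Z \<le> t * rval F Y + (1 - t) * rval F Q"
    proof (cases "t = 1")
      case False
      then show ?thesis using t Y Q pos_def_edom by (intro rval_convex(2)) auto
    qed simp
    then have "?g ?Z \<le> t * ?g Y + (1 - t) * ?g Q"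
      by (simp add: inner_add_right algebra_simps)
    with 1 have "e \<le> t * (?g Y - ?g Q)" by (simp add: algebra_simps)
    then have "e / t \<le> ?g Y - ?g Q" using t by (simp add: field_simps)
    moreover have "e / t = e / r * norm (Y - Q)" by (simp add: t_def)
    ultimately show ?thesis by simp
  qed
  then show ?thesis using that[of r "e / r"] r e by simp
qed

lemma lower_semicont_limit:
  assumes "\<And>n. Y n \<in> edom F" "Y \<longlonglongrightarrow> X" "(\<lambda>n. rval F (Y n)) \<longlonglongrightarrow> l"
  shows "X \<in> edom F" and "rval F X \<le> l"
proof -
  have X: "X \<in> sym_mats"
    using closed_sequentially[OF closed_sym_mats] assms(1,2) edom_sym by blast
  have lsc: "F X \<le> Liminf (at X within sym_mats) F"
    using F X by (auto simp: class_E_def lower_semicont_def)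
  have "(\<lambda>n. ereal (rval F (Y n))) \<longlonglongrightarrow> ereal l"
    using assms(3) by simp
  then have lim: "(\<lambda>n. F (Y n)) \<longlonglongrightarrow> ereal l"
    by (simp only: edom_value[OF assms(1), symmetric])
  have "y \<le> ereal l" if y: "y < F X" for y
  proof -
    have "\<forall>\<^sub>F Z in at X within sym_mats. y < F Z"
      using lsc y unfolding le_Liminf_iff by blast
    then obtain S where S: "open S" "X \<in> S" "\<And>Z. Z \<in> S \<Longrightarrow> Z \<noteq> X \<Longrightarrow> Z \<in> sym_mats \<Longrightarrow> y < F Z"
      unfolding eventually_at_topological by blast
    have "\<forall>\<^sub>F n in sequentially. Y n \<in> S"
      using topological_tendstoD[OF assms(2) S(1,2)] .
    then have "\<forall>\<^sub>F n in sequentially. y \<le> F (Y n)"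
    proof eventually_elim
      case (elim n)
      then show ?case using S(3)[of "Y n"] y edom_sym[OF assms(1), of n]
        by (cases "Y n = X") auto
    qed
    then show ?thesis using tendsto_lowerbound[OF lim] by simp
  qed
  then have le: "F X \<le> ereal l" by (rule dense_le)
  then show XE: "X \<in> edom F" using X by (auto simp: edom_def)
  show "rval F X \<le> l"
    using le edom_value[OF XE] by (metis ereal_less_eq(3))
qed

lemma tilted_attains_min:
  assumes Q: "Q \<in> pos_def" and C: "closed C" and P: "P \<in> C" "P \<in> edom F"
  obtains X where "X \<in> C" "X \<in> edom F"
    "\<And>Y. Y \<in> C \<Longrightarrow> Y \<in> edom F \<Longrightarrow> rval F X - grad F Q \<bullet> X \<le> rval F Y - grad F Q \<bullet> Y"
proof -
  let ?g = "\<lambda>Y. rval F Y - grad F Q \<bullet> Y"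
  let ?D = "C \<inter> edom F"
  obtain r e where re: "r > 0" "e > 0"
    and grow: "\<And>Y. Y \<in> edom F \<Longrightarrow> r \<le> norm (Y - Q) \<Longrightarrow> ?g Q + e * norm (Y - Q) \<le> ?g Y"
    using tilted_coercive[OF Q] by blast
  have lb: "?g Q \<le> ?g Y" if "Y \<in> edom F" for Y
    using gradient_inequality[OF Q that] by (simp add: inner_diff_right)
  define m where "m = Inf (?g ` ?D)"
  have bdd: "bdd_below (?g ` ?D)" using lb by (auto intro!: bdd_belowI[of _ "?g Q"])
  have ne: "?g ` ?D \<noteq> {}" using P by auto
  have mle: "m \<le> ?g Y" if "Y \<in> ?D" for Y
    unfolding m_def using bdd that by (intro cInf_lower) auto
  have "\<exists>Y\<in>?D. ?g Y < m + 1 / (real n + 1)" for n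
  proof -
    have "Inf (?g ` ?D) < m + 1 / (real n + 1)" by (simp add: m_def)
    from cInf_lessD[OF ne this] show ?thesis by auto
  qed
  then obtain Y where Y: "\<And>n. Y n \<in> ?D" "\<And>n. ?g (Y n) < m + 1 / (real n + 1)" by metis
  have lim: "(\<lambda>n. ?g (Y n)) \<longlonglongrightarrow> m"
  proof (rule tendsto_sandwich)
    show "\<forall>\<^sub>F n in sequentially. m \<le> ?g (Y n)" using mle Y by (intro always_eventually) blast
    show "\<forall>\<^sub>F n in sequentially. ?g (Y n) \<le> m + 1 / (real n + 1)"
      using Y(2) less_imp_le by (intro always_eventually) blast
    show "(\<lambda>n. m + 1 / (real n + 1)) \<longlonglongrightarrow> m"
      using tendsto_add[OF tendsto_const LIMSEQ_inverse_real_of_nat, of m]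
      by (simp add: inverse_eq_divide add.commute)
  qed simp
  have "norm (Y n - Q) \<le> max r ((m + 1 - ?g Q) / e)" for n
  proof (cases "r \<le> norm (Y n - Q)")
    case True
    have "?g Q + e * norm (Y n - Q) \<le> ?g (Y n)" using grow True Y by blast
    also have "\<dots> \<le> m + 1"
    proof -
      have "1 / (real n + 1) \<le> 1" by simp
      then show ?thesis using Y(2)[of n] by linarith
    qed
    finally have "norm (Y n - Q) \<le> (m + 1 - ?g Q) / e" using re by (simp add: field_simps)
    then show ?thesis by simp
  qed simp
  then have "bounded (range Y)"
    by (intro boundedI[of _ "max r ((m + 1 - ?g Q) / e) + norm Q"])
      (smt (verit) norm_triangle_sub rangeE)
  then obtain X s where s: "strict_mono (s :: nat \<Rightarrow> nat)" and YX: "(Y \<circ> s) \<longlonglongrightarrow> X"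
    using bounded_imp_convergent_subsequence by blast
  have XC: "X \<in> C" using closed_sequentially[OF C _ YX] Y by auto
  have "(\<lambda>n. ?g (Y (s n)) + grad F Q \<bullet> Y (s n)) \<longlonglongrightarrow> m + grad F Q \<bullet> X"
    using LIMSEQ_subseq_LIMSEQ[OF lim s] YX by (intro tendsto_intros) (auto simp: o_def)
  then have l: "(\<lambda>n. rval F ((Y \<circ> s) n)) \<longlonglongrightarrow> m + grad F Q \<bullet> X" by simp
  have YE: "(Y \<circ> s) n \<in> edom F" for n using Y by simp
  note X = lower_semicont_limit[OF YE YX l]
  show ?thesis
  proof (rule that[OF XC X(1)])
    show "?g X \<le> ?g Z" if "Z \<in> C" "Z \<in> edom F" for Z
      using mle[of Z] that X(2) by auto
  qed
qed

text \<open>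
  The hypothesis on \<open>X\<close> only concerns minimality on the segment towards an interior point \<open>P\<close>.
\<close>

lemma minimizer_pos_def:
  assumes ess: "essentially_smooth F" and L: "L \<in> sym_mats"
    and X: "X \<in> edom F" and P: "P \<in> pos_def"
    and min: "\<And>t. 0 < t \<Longrightarrow> t \<le> 1 \<Longrightarrow>
      rval F X - L \<bullet> X \<le> rval F (t *\<^sub>R P + (1 - t) *\<^sub>R X) - L \<bullet> (t *\<^sub>R P + (1 - t) *\<^sub>R X)"
  shows "X \<in> pos_def"
proof (rule ccontr)
  assume notpd: "X \<notin> pos_def"
  let ?g = "\<lambda>Y. rval F Y - L \<bullet> Y"
  obtain r where r: "r > 0" "cball P r \<inter> sym_mats \<subseteq> pos_def"
    using pos_def_ball[OF P] .
  let ?K = "cball P r \<inter> sym_mats"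
  have comp: "compact (?g ` ?K)"
    by (intro compact_continuous_image continuous_intros continuous_on_subset[OF continuous_on_rval r(2)]
        compact_Int_closed compact_cball closed_sym_mats)
  obtain b where b: "\<And>U. U \<in> ?K \<Longrightarrow> ?g U \<le> b"
    using bounded_imp_bdd_above[OF compact_imp_bounded[OF comp]] unfolding bdd_above_def by fast
  define S where "S k = (1 / (real k + 1)) *\<^sub>R P + (1 - 1 / (real k + 1)) *\<^sub>R X" for k :: nat
  have Spd: "S k \<in> pos_def" for k
    unfolding S_def using P edom_pos_semidef[OF X] by (intro pos_def_segment) auto
  have bound: "norm (grad F (S k)) \<le> (b - ?g X) / r + norm L" for k
  proof -
    define t where "t = 1 / (real k + 1)"
    have t: "0 < t" "t \<le> 1" by (auto simp: t_def)
    have St: "S k = t *\<^sub>R P + (1 - t) *\<^sub>R X" by (simp add: S_def t_def)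
    define G where "G = grad F (S k) - L"
    have Gsym: "G \<in> sym_mats"
      unfolding G_def using L grad_sym[OF Spd] by (intro subspace_diff subspace_sym_mats)
    have supp: "?g (S k) + G \<bullet> (U - S k) \<le> ?g U" if "U \<in> edom F" for U
      using gradient_inequality[OF Spd that, of k]
      by (simp add: G_def inner_diff_left inner_diff_right)
    have low: "?g X \<le> ?g (S k)" unfolding St using min[OF t] .
    have XS: "X - S k = (- t) *\<^sub>R (P - X)" by (simp add: St algebra_simps)
    have "0 \<le> t * (G \<bullet> (P - X))"
      using supp[OF X] low unfolding XS by simp
    then have up: "0 \<le> G \<bullet> (P - X)" using t by (simp add: zero_le_mult_iff)
    \<comment> \<open>Evaluate the supporting hyperplane at the point of the ball furthest in direction \<open>G\<close>.\<close>
    define U where "U = P + (r / norm G) *\<^sub>R G"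
    have UK: "U \<in> ?K"
      unfolding U_def using r(1) P Gsym
      by (auto simp: dist_norm pos_def_sym intro!: subspace_add subspace_scale subspace_sym_mats)
    have US: "U - S k = (1 - t) *\<^sub>R (P - X) + (r / norm G) *\<^sub>R G"
      by (simp add: U_def St algebra_simps)
    have "G \<bullet> (U - S k) = (1 - t) * (G \<bullet> (P - X)) + r * norm G"
      unfolding US by (simp add: inner_add_right dot_square_norm power2_eq_square)
    moreover have "(1 - t) * (G \<bullet> (P - X)) \<ge> 0" using up t by simp
    moreover have "?g (S k) + G \<bullet> (U - S k) \<le> ?g U"
      using supp UK r(2) pos_def_edom by blast
    moreover have "?g U \<le> b" using b UK by blast
    ultimately have "r * norm G \<le> b - ?g X" using low by linarith
    then have "norm G \<le> (b - ?g X) / r" using r(1) by (simp add: field_simps)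
    moreover have "norm (grad F (S k)) \<le> norm G + norm L"
      using norm_triangle_ineq[of G L] by (simp add: G_def)
    ultimately show ?thesis by linarith
  qed
  have lim: "S \<longlonglongrightarrow> X"
  proof -
    have "(\<lambda>k. 1 / (real k + 1)) \<longlonglongrightarrow> 0"
      using LIMSEQ_inverse_real_of_nat by (simp add: inverse_eq_divide add.commute)
    then have "(\<lambda>k. (1 / (real k + 1)) *\<^sub>R P + (1 - 1 / (real k + 1)) *\<^sub>R X) \<longlonglongrightarrow> 0 *\<^sub>R P + (1 - 0) *\<^sub>R X"
      by (intro tendsto_intros)
    then show ?thesis by (simp add: S_def[abs_def])
  qed
  have "edom F \<subseteq> topspace (top_of_set sym_mats)" by (auto simp: edom_sym)
  then have "X \<in> bdry_dom F"
    using X notpd int_dom_eq_pos_def closure_of_subset[of "edom F" "top_of_set sym_mats"]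
    by (auto simp: bdry_dom_def frontier_of_def int_dom_def)
  then have "filterlim (\<lambda>k. norm (grad F (S k))) at_top sequentially"
    using ess lim Spd by (auto simp: essentially_smooth_def int_dom_eq_pos_def)
  then have "\<forall>\<^sub>F k in sequentially. (b - ?g X) / r + norm L < norm (grad F (S k))"
    by (simp add: filterlim_at_top_dense)
  then show False using bound by (auto simp: eventually_sequentially not_less[symmetric])
qed

lemma minimizer_stationary:
  assumes X: "X \<in> pos_def" and H: "H \<in> sym_mats"
    and min: "\<And>t. X + t *\<^sub>R H \<in> edom F \<Longrightarrow> rval F X - L \<bullet> X \<le> rval F (X + t *\<^sub>R H) - L \<bullet> (X + t *\<^sub>R H)"
  shows "grad F X \<bullet> H = L \<bullet> H"
proof -
  obtain r where r: "r > 0" "cball X r \<inter> sym_mats \<subseteq> pos_def"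
    using pos_def_ball[OF X] .
  define d where "d = r / (norm H + 1)"
  have nH: "norm H + 1 > 0" by (simp add: add_nonneg_pos)
  have d: "d > 0" using r nH by (simp add: d_def)
  have near: "X + t *\<^sub>R H \<in> edom F" if "\<bar>t\<bar> < d" for t
  proof -
    have "\<bar>t\<bar> * norm H \<le> d * (norm H + 1)"
      using that by (intro mult_mono) auto
    then have "X + t *\<^sub>R H \<in> cball X r" using nH by (simp add: dist_norm d_def)
    moreover have "X + t *\<^sub>R H \<in> sym_mats"
      using X H pos_def_sym by (intro subspace_add subspace_scale subspace_sym_mats) auto
    ultimately show ?thesis using r(2) pos_def_edom by blast
  qed
  let ?h = "\<lambda>t. rval F (X + t *\<^sub>R H) - t * (L \<bullet> H)"
  have "(?h has_real_derivative grad F X \<bullet> H - L \<bullet> H) (at 0)"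
    by (auto intro!: derivative_eq_intros has_gradient_line[OF has_gradient_grad[OF X] H])
  moreover have "\<forall>y. \<bar>0 - y\<bar> < d \<longrightarrow> ?h 0 \<le> ?h y"
    using min[OF near] by (auto simp: inner_add_right)
  ultimately have "grad F X \<bullet> H - L \<bullet> H = 0" using d DERIV_local_min by blast
  then show ?thesis by simp
qed

end

section \<open>The mixed parametrisation\<close>

text \<open>Symmetric matrix units detect the entries of a symmetric matrix.\<close>

lemma sym_unit:
  fixes i j :: "'m::finite"
  defines "E \<equiv> (\<chi> k l. if k = i \<and> l = j \<or> k = j \<and> l = i then 1 else 0) :: real^'m^'m"
  shows "E \<in> sym_mats" and "M \<in> sym_mats \<Longrightarrow> M \<bullet> E = 0 \<Longrightarrow> M $ i $ j = 0"
proof -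
  show "E \<in> sym_mats" by (auto simp: E_def sym_mats_def transpose_def vec_eq_iff)
  assume M: "M \<in> sym_mats" "M \<bullet> E = 0"
  have "M \<bullet> E = (\<Sum>k\<in>UNIV. \<Sum>l\<in>UNIV. if (k, l) \<in> {(i, j), (j, i)} then M $ k $ l else 0)"
    unfolding inner_vec_def inner_real_def by (intro sum.cong refl) (auto simp: E_def)
  also have "\<dots> = (\<Sum>p\<in>UNIV \<times> UNIV. if p \<in> {(i, j), (j, i)} then M $ fst p $ snd p else 0)"
    unfolding sum.cartesian_product by (intro sum.cong refl) (simp only: case_prod_beta prod.collapse)
  also have "\<dots> = (\<Sum>p\<in>{(i, j), (j, i)}. M $ fst p $ snd p)"
    by (subst sum.inter_restrict[symmetric]) simp_all
  also have "\<dots> = (if i = j then M $ i $ j else 2 * M $ i $ j)"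
    using sym_mats_nth[OF M(1), of j i] by auto
  finally show "M $ i $ j = 0" using M(2) by (auto split: if_splits)
qed

theorem theorem5p4:
  fixes F :: "real^('m::{finite,linorder})^('m::{finite,linorder}) \<Rightarrow> ereal"
    and A B :: "('m \<times> 'm) set"
  assumes "F \<in> class_E"
    and "essentially_smooth F"
    and "A \<union> B = entries" and "A \<inter> B = {}"
  shows "bij_betw (\<lambda>\<Sigma>. (coords A \<Sigma>, coords B (grad F \<Sigma>)))
           pos_def (coords A ` pos_def \<times> coords B ` L_plus F)"
proof -
  note F = assms(1)
  have inj: "X = Y" if X: "X \<in> pos_def" and Y: "Y \<in> pos_def"
    and eqA: "coords A X = coords A Y" and eqB: "coords B (grad F X) = coords B (grad F Y)" for X Y
  proof (rule ccontr)
    assume "X \<noteq> Y"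
    then have "(Y - X) \<bullet> (grad F Y - grad F X) > 0" by (rule grad_strict_mono[OF F X Y])
    moreover have "(Y - X) \<bullet> (grad F Y - grad F X) = 0"
      using eqA eqB X Y F
      by (intro inner_eq_zero_if_complementary[OF assms(3)])
        (auto simp: coords_eq_iff pos_def_sym grad_sym intro!: subspace_diff[OF subspace_sym_mats])
    ultimately show False by simp
  qed
  have surj: "\<exists>X\<in>pos_def. coords A X = coords A P \<and> coords B (grad F X) = coords B (grad F Q)"
    if P: "P \<in> pos_def" and Q: "Q \<in> pos_def" for P Q
  proof -
    let ?C = "{Y. coords A Y = coords A P}"
    let ?L = "grad F Q"
    obtain X where XC: "X \<in> ?C" and XE: "X \<in> edom F"
      and min: "\<And>Y. Y \<in> ?C \<Longrightarrow> Y \<in> edom F \<Longrightarrow> rval F X - ?L \<bullet> X \<le> rval F Y - ?L \<bullet> Y"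
      by (rule tilted_attains_min[OF F Q closed_coords_fiber[of A P] _ pos_def_edom[OF F P]]) auto
    have Xpd: "X \<in> pos_def"
    proof (rule minimizer_pos_def[OF F assms(2) grad_sym[OF F Q] XE P])
      fix t :: real assume t: "0 < t" "t \<le> 1"
      show "rval F X - ?L \<bullet> X \<le> rval F (t *\<^sub>R P + (1 - t) *\<^sub>R X) - ?L \<bullet> (t *\<^sub>R P + (1 - t) *\<^sub>R X)"
      proof (rule min)
        show "t *\<^sub>R P + (1 - t) *\<^sub>R X \<in> ?C" using XC by (auto simp: coords_eq_iff algebra_simps)
        show "t *\<^sub>R P + (1 - t) *\<^sub>R X \<in> edom F"
          using pos_def_segment[OF P edom_pos_semidef[OF F XE] t] by (rule pos_def_edom[OF F])
      qed
    qed
    have "grad F X $ i $ j = ?L $ i $ j" if ij: "(i, j) \<in> B" for i j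
    proof -
      define E where "E = (\<chi> k l. if k = i \<and> l = j \<or> k = j \<and> l = i then (1::real) else 0)"
      have E: "E \<in> sym_mats" unfolding E_def by (rule sym_unit(1))
      \<comment> \<open>The reflected position \<open>(j, i)\<close> is not in \<open>A\<close> either: entries lie on or above the diagonal.\<close>
      have "E $ k $ l = 0" if "(k, l) \<in> A" for k l
      proof -
        have "k \<le> l" "i \<le> j" "(k, l) \<noteq> (i, j)" using that ij assms(3,4) by (auto simp: entries_def)
        then show ?thesis by (auto simp: E_def)
      qed
      then have "X + t *\<^sub>R E \<in> ?C" for t using XC by (auto simp: coords_eq_iff)
      then have "grad F X \<bullet> E = ?L \<bullet> E"
        using min by (intro minimizer_stationary[OF F Xpd E]) blast
      then have "(grad F X - ?L) \<bullet> E = 0" by (simp add: inner_diff_left)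
      moreover have "grad F X - ?L \<in> sym_mats"
        using grad_sym[OF F Xpd] grad_sym[OF F Q] by (intro subspace_diff subspace_sym_mats)
      ultimately have "(grad F X - ?L) $ i $ j = 0" unfolding E_def by (intro sym_unit(2))
      then show ?thesis by simp
    qed
    then show ?thesis using Xpd XC by (auto simp: coords_eq_iff)
  qed
  show ?thesis
    unfolding bij_betw_def
  proof
    show "inj_on (\<lambda>\<Sigma>. (coords A \<Sigma>, coords B (grad F \<Sigma>))) pos_def"
      using inj by (auto intro!: inj_onI)
    show "(\<lambda>\<Sigma>. (coords A \<Sigma>, coords B (grad F \<Sigma>))) ` pos_def = coords A ` pos_def \<times> coords B ` L_plus F"
    proof
      show "coords A ` pos_def \<times> coords B ` L_plus F
          \<subseteq> (\<lambda>\<Sigma>. (coords A \<Sigma>, coords B (grad F \<Sigma>))) ` pos_def"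
      proof
        fix z assume "z \<in> coords A ` pos_def \<times> coords B ` L_plus F"
        then obtain P Q where "P \<in> pos_def" "Q \<in> pos_def" and z: "z = (coords A P, coords B (grad F Q))"
          by (auto simp: L_plus_def)
        then obtain X where "X \<in> pos_def" "z = (coords A X, coords B (grad F X))"
          using surj[of P Q] by auto
        then show "z \<in> (\<lambda>\<Sigma>. (coords A \<Sigma>, coords B (grad F \<Sigma>))) ` pos_def"
          by blast
      qed
    qed (auto simp: L_plus_def)
  qed
qed

end
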